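(* Let $(B,+,\cdot)$ be a skew brace. If $(B,\cdot)$ is cyclic of order $p^n$ for some odd prime $p$, then $(B,+) \cong (B,\cdot)$.
   Context: A skew brace (skew left brace) is a triple $(B,+,\cdot)$ such that $(B,+)$ and $(B,\cdot)$ are groups (neither assumed abelian) and $a\cdot(b+c)=a\cdot b-a+a\cdot c$ for all $a,b,c\in B$, where $-a$ is the inverse of $a$ in $(B,+)$. *)

theory Defs
  imports "HOL-Algebra.Algebra"
begin

(* The library's ring record is used only as a container for one carrier set with two
   operations; no ring axioms are involved. The record itself, viewed as a monoid, is
   (B, \<cdot>), with all elements of the carrier (including \<zero>) invertible.
   The brace equation is not symmetric in its summands, since addition need not commute. *)
locale skew_brace = additive: group "add_monoid B" + multiplicative: group B
  for B :: "('a, 'b) ring_scheme" (structure) +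
  assumes brace_distrib:
    "\<lbrakk> a \<in> carrier B; b \<in> carrier B; c \<in> carrier B \<rbrakk> \<Longrightarrow>
      a \<otimes> (b \<oplus> c) = (a \<otimes> b \<ominus> a) \<oplus> a \<otimes> c"

end

theory Submission
  imports Defs
begin

text \<open>
  Write $\lambda_a(x) = -a + ax$. Then $\lambda$ is an action of $C = (B,\cdot)$ on
  $(B,+)$, and the identity $B \to B$ is a crossed homomorphism $\pi$ for it, that is,
  $\pi(ab) = \pi(a) + \lambda_a(\pi(b))$. A pair $(\lambda,\pi)$ with $\pi$ surjective passes
  to quotients of $(B,+)$ by $\lambda$-invariant normal subgroups, so by induction it suffices
  to show that such a group $Q$ is cyclic if all its proper invariant quotients are.
  The centre of $Q$ is nontrivial, so $Q$ is central-by-cyclic, hence abelian. If $pQ \neq 0$,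
  cyclicity of $Q/pQ$ gives that of $Q$. If $pQ = 0$, let $\gamma$ generate $C$ and
  $t = \lambda_\gamma - 1$; the quotient by the (nontrivial) fixed points of $C$ is cyclic, which
  forces $t^2 = 0$. With $u = \pi(\gamma)$ we get $\pi(\gamma^k) = ku + {k \choose 2} tu$, which
  depends only on $k$ modulo $p$ because $p$ is odd; hence $Q$ has at most $p$ elements.
\<close>

section \<open>Fixed points of finite p-group actions\<close>

text \<open>Without a fixed point no orbit has size 1. Orbit sizes divide \<open>p ^ n\<close>, so
  all of them, and hence their sum \<open>card E\<close>, would be multiples of \<open>p\<close>.
  The action is given by bare laws on \<open>E\<close>, so that the lemma applies directly to sets
  such as a group without its identity.\<close>

lemma p_group_fixed_point:
  assumes C: "group C" and p: "Factorial_Ring.prime p" and ord: "Coset.order C = p ^ n"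
    and fin: "finite E" and closed: "\<And>a x. a \<in> carrier C \<Longrightarrow> x \<in> E \<Longrightarrow> act a x \<in> E"
    and mult: "\<And>a b x. a \<in> carrier C \<Longrightarrow> b \<in> carrier C \<Longrightarrow> x \<in> E \<Longrightarrow> act (a \<otimes>\<^bsub>C\<^esub> b) x = act a (act b x)"
    and one: "\<And>x. x \<in> E \<Longrightarrow> act \<one>\<^bsub>C\<^esub> x = x"
    and card: "\<not> p dvd card E"
  shows "\<exists>x\<in>E. \<forall>a\<in>carrier C. act a x = x"
proof (rule ccontr)
  assume no: "\<not> ?thesis"
  interpret C: group C by fact
  \<comment> \<open>Elements of \<open>Bij E\<close> are undefined outside \<open>E\<close>, so the
    action must be restricted before it is a homomorphism into \<open>BijGroup E\<close>.\<close>
  define \<phi> where "\<phi> = (\<lambda>a. restrict (act a) E)"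
  have inv_act: "act (inv\<^bsub>C\<^esub> a) (act a x) = x" "act a (act (inv\<^bsub>C\<^esub> a) x) = x"
    if "a \<in> carrier C" "x \<in> E" for a x
    using that mult[of "inv\<^bsub>C\<^esub> a" a x] mult[of a "inv\<^bsub>C\<^esub> a" x] one by auto
  have bij: "\<phi> a \<in> Bij E" if "a \<in> carrier C" for a
  proof -
    have "bij_betw (act a) E E"
      by (rule bij_betw_byWitness[where f' = "act (inv\<^bsub>C\<^esub> a)"]) (use that inv_act closed in auto)
    then show ?thesis
      by (simp add: \<phi>_def Bij_def cong: bij_betw_cong)
  qed
  have "\<phi> \<in> hom C (BijGroup E)"
  proof (rule homI)
    fix a b assume "a \<in> carrier C" "b \<in> carrier C"
    then show "\<phi> (a \<otimes>\<^bsub>C\<^esub> b) = \<phi> a \<otimes>\<^bsub>BijGroup E\<^esub> \<phi> b"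
      using bij by (auto simp: BijGroup_def compose_def \<phi>_def mult closed fun_eq_iff)
  qed (simp add: BijGroup_def bij)
  then interpret A: group_action C E \<phi>
    by (simp add: group_action_def group_hom_def group_hom_axioms_def group_BijGroup C)
  have "p dvd card (orbit C \<phi> x)" if x: "x \<in> E" for x
  proof -
    have "card (orbit C \<phi> x) dvd p ^ n"
      by (metis A.orbit_stabilizer_theorem dvd_triv_left ord x)
    moreover have "card (orbit C \<phi> x) \<noteq> 1"
    proof
      assume "card (orbit C \<phi> x) = 1"
      then obtain y where y: "orbit C \<phi> x = {y}"
        by (meson card_1_singletonE)
      then have "y = x" using A.orbit_refl[OF x] by simp
      then have "\<forall>a\<in>carrier C. act a x = x"
        using y x by (auto simp: orbit_def \<phi>_def)
      then show False using no x by blast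
    qed
    ultimately show ?thesis
      using p by (metis divides_primepow_nat dvd_power_same dvd_refl power_0 dvd_power not_gr_zero)
  qed
  then have "p dvd (\<Sum>orb\<in>orbits C E \<phi>. card orb)"
    by (intro dvd_sum) (auto simp: orbits_def)
  also have "(\<Sum>orb\<in>orbits C E \<phi>. card orb) = card E"
    using A.disjoint_sum[OF fin, of "\<lambda>_. 1::nat"] by simp
  finally show False using card by simp
qed

section \<open>Surjective crossed homomorphisms and their quotients\<close>

text \<open>This structure is weaker than a skew brace, where \<open>\<pi>\<close> is the identity
  of a common carrier. Only surjectivity of \<open>\<pi>\<close> is required, because that survives
  passing to quotients of \<open>Q\<close> while \<open>C\<close> stays fixed; injectivity would
  not.\<close>

locale cocycle = group Q + C: group C
  for Q :: "('q, 'x) monoid_scheme" (structure) and C :: "('c, 'y) monoid_scheme" +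
  fixes act :: "'c \<Rightarrow> 'q \<Rightarrow> 'q" and \<pi> :: "'c \<Rightarrow> 'q"
  assumes act_hom: "a \<in> carrier C \<Longrightarrow> act a \<in> hom Q Q"
    and act_mult: "\<lbrakk>a \<in> carrier C; b \<in> carrier C; x \<in> carrier Q\<rbrakk> \<Longrightarrow> act (a \<otimes>\<^bsub>C\<^esub> b) x = act a (act b x)"
    and act_one: "x \<in> carrier Q \<Longrightarrow> act \<one>\<^bsub>C\<^esub> x = x"
    and cocycle_mult: "\<lbrakk>a \<in> carrier C; b \<in> carrier C\<rbrakk> \<Longrightarrow> \<pi> (a \<otimes>\<^bsub>C\<^esub> b) = \<pi> a \<otimes> act a (\<pi> b)"
    and cocycle_surj: "\<pi> ` carrier C = carrier Q"
begin

definition invariant_normal :: "'q set \<Rightarrow> bool"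
  where "invariant_normal K \<longleftrightarrow> K \<lhd> Q \<and> (\<forall>a\<in>carrier C. \<forall>x\<in>K. act a x \<in> K)"

text \<open>Cyclicity of \<open>Q Mod K\<close>, expressed by elements of \<open>Q\<close> instead
  of cosets. For \<open>K = {\<one>}\<close> it is cyclicity of \<open>Q\<close> itself.\<close>

definition cyclic_modulo :: "'q set \<Rightarrow> bool"
  where "cyclic_modulo K \<longleftrightarrow>
    (\<exists>g\<in>carrier Q. \<forall>x\<in>carrier Q. \<exists>k\<in>K. \<exists>j::int. x = k \<otimes> g [^] j)"

lemma group_hom_act: "a \<in> carrier C \<Longrightarrow> group_hom Q Q (act a)"
  by unfold_locales (rule act_hom)

lemma act_closed [simp]: "\<lbrakk>a \<in> carrier C; x \<in> carrier Q\<rbrakk> \<Longrightarrow> act a x \<in> carrier Q"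
  using act_hom by (auto simp: hom_def)

lemma act_distrib: "\<lbrakk>a \<in> carrier C; x \<in> carrier Q; y \<in> carrier Q\<rbrakk> \<Longrightarrow> act a (x \<otimes> y) = act a x \<otimes> act a y"
  using act_hom by (auto simp: hom_def)

lemma act_unit [simp]: "a \<in> carrier C \<Longrightarrow> act a \<one> = \<one>"
  by (rule group_hom.hom_one[OF group_hom_act])

lemma act_inv: "\<lbrakk>a \<in> carrier C; x \<in> carrier Q\<rbrakk> \<Longrightarrow> act a (inv x) = inv (act a x)"
  by (rule group_hom.hom_inv[OF group_hom_act])

lemma act_nat_pow: "\<lbrakk>a \<in> carrier C; x \<in> carrier Q\<rbrakk> \<Longrightarrow> act a (x [^] (k::nat)) = act a x [^] k"
  by (rule group_hom.hom_nat_pow[OF group_hom_act])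

lemma act_inv_act [simp]:
  assumes "a \<in> carrier C" "x \<in> carrier Q"
  shows "act (inv\<^bsub>C\<^esub> a) (act a x) = x" "act a (act (inv\<^bsub>C\<^esub> a) x) = x"
  using assms act_mult[of "inv\<^bsub>C\<^esub> a" a x] act_mult[of a "inv\<^bsub>C\<^esub> a" x] act_one by auto

lemma act_eq_one_iff: "\<lbrakk>a \<in> carrier C; x \<in> carrier Q\<rbrakk> \<Longrightarrow> act a x = \<one> \<longleftrightarrow> x = \<one>"
  by (metis C.inv_closed act_inv_act(1) act_unit)

lemma cocycle_closed [simp]: "a \<in> carrier C \<Longrightarrow> \<pi> a \<in> carrier Q"
  using cocycle_surj by blast

text \<open>Makes taking images of cosets the induced action on \<open>Q Mod K\<close>. The inverse
  of \<open>a\<close> also preserves \<open>K\<close>, so every element of \<open>K\<close> is an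
  \<open>act a\<close>-image of one in \<open>K\<close>; this gives the inclusion from right to
  left.\<close>

lemma act_rcoset:
  assumes K: "invariant_normal K" and a: "a \<in> carrier C" and x: "x \<in> carrier Q"
  shows "act a ` (K #> x) = K #> act a x"
proof -
  have KQ: "K \<subseteq> carrier Q"
    using K by (auto simp: invariant_normal_def normal_def subgroup_def)
  have inv: "act b k \<in> K" if "b \<in> carrier C" "k \<in> K" for b k
    using K that by (simp add: invariant_normal_def)
  show ?thesis
  proof
    show "act a ` (K #> x) \<subseteq> K #> act a x"
      using KQ inv[OF a] by (auto simp: r_coset_def act_distrib a x subset_iff)
    show "K #> act a x \<subseteq> act a ` (K #> x)"
    proof
      fix y assume "y \<in> K #> act a x"
      then obtain k where k: "k \<in> K" "y = k \<otimes> act a x" by (auto simp: r_coset_def)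
      then have "y = act a (act (inv\<^bsub>C\<^esub> a) k \<otimes> x)"
        using KQ a x by (simp add: act_distrib subset_iff)
      moreover have "act (inv\<^bsub>C\<^esub> a) k \<otimes> x \<in> K #> x"
        using inv[of "inv\<^bsub>C\<^esub> a" k] a k by (auto simp: r_coset_def)
      ultimately show "y \<in> act a ` (K #> x)" by blast
    qed
  qed
qed

lemma quotient_cocycle:
  assumes K: "invariant_normal K"
  shows "cocycle (Q Mod K) C (\<lambda>a S. act a ` S) (\<lambda>a. K #> \<pi> a)"
proof -
  interpret K: normal K Q
    using K by (simp add: invariant_normal_def)
  interpret QK: group "Q Mod K" by (rule K.factorgroup_is_group)
  have ac: "act a ` (K #> x) = K #> act a x" if "a \<in> carrier C" "x \<in> carrier Q" for a x
    using act_rcoset[OF K that] .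
  have rep: "\<exists>x\<in>carrier Q. S = K #> x" if "S \<in> carrier (Q Mod K)" for S
    using that by (auto simp: carrier_FactGroup)
  show ?thesis
  proof
    fix a assume a: "a \<in> carrier C"
    then show "(`) (act a) \<in> hom (Q Mod K) (Q Mod K)"
      by (auto simp: hom_def carrier_FactGroup ac K.rcos_sum act_distrib)
    fix b assume b: "b \<in> carrier C"
    show "act (a \<otimes>\<^bsub>C\<^esub> b) ` S = act a ` act b ` S" if "S \<in> carrier (Q Mod K)" for S
      using rep[OF that] a b by (metis C.m_closed ac act_closed act_mult)
    show "K #> \<pi> (a \<otimes>\<^bsub>C\<^esub> b) = (K #> \<pi> a) \<otimes>\<^bsub>Q Mod K\<^esub> act a ` (K #> \<pi> b)"
      using a b by (simp add: ac cocycle_mult K.rcos_sum)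
  next
    show "act \<one>\<^bsub>C\<^esub> ` S = S" if "S \<in> carrier (Q Mod K)" for S
      using rep[OF that] by (metis C.one_closed ac act_one)
    show "(\<lambda>a. K #> \<pi> a) ` carrier C = carrier (Q Mod K)"
      by (simp add: carrier_FactGroup cocycle_surj[symmetric] image_image)
  qed
qed

end

section \<open>Subgroups and centre of a p-group\<close>

lemma (in group) p_dvd_card_subgroup:
  assumes "Factorial_Ring.prime (p::nat)" "Coset.order G = p ^ m" "subgroup S G" "S \<noteq> {\<one>}"
  shows "p dvd card S"
proof -
  have "card S dvd p ^ m"
    by (metis assms(2,3) dvd_triv_right lagrange)
  moreover have "card S \<noteq> 1"
    by (metis assms(3,4) card_1_singletonE singletonD subgroup.one_closed)
  ultimately show ?thesis
    using assms(1) by (metis divides_primepow_nat dvd_power not_gr_zero power_0)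
qed

text \<open>The group acts by conjugation on its non-identity elements. Their number is one less
  than a multiple of \<open>p\<close>, so some element is fixed, that is, central.\<close>

lemma (in group) p_group_center_nontrivial:
  assumes p: "Factorial_Ring.prime (p::nat)" and ord: "Coset.order G = p ^ m" and "carrier G \<noteq> {\<one>}"
  shows "\<exists>z\<in>carrier G. z \<noteq> \<one> \<and> (\<forall>x\<in>carrier G. x \<otimes> z = z \<otimes> x)"
proof -
  have fin: "finite (carrier G)"
    using ord p by (metis card.infinite order_def power_eq_0_iff not_prime_0)
  have "p dvd card (carrier G)"
    using assms by (intro p_dvd_card_subgroup subgroup_self)
  moreover have "card (carrier G) = Suc (card (carrier G - {\<one>}))"
    using fin by (metis card_Suc_Diff1 one_closed)
  ultimately have nd: "\<not> p dvd card (carrier G - {\<one>})"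
    using p by (metis Suc_eq_plus1 dvd_add_right_iff not_prime_unit)
  have "\<exists>z\<in>carrier G - {\<one>}. \<forall>a\<in>carrier G. a \<otimes> z \<otimes> inv a = z"
  proof (rule p_group_fixed_point[OF is_group p ord _ _ _ _ nd])
    fix a x assume ax: "a \<in> carrier G" "x \<in> carrier G - {\<one>}"
    have "a \<otimes> x = a \<otimes> x \<otimes> inv a \<otimes> a" using ax by (simp add: m_assoc)
    then have "a \<otimes> x \<otimes> inv a \<noteq> \<one>" using ax by auto
    then show "a \<otimes> x \<otimes> inv a \<in> carrier G - {\<one>}" using ax by simp
  qed (use fin in \<open>auto simp: m_assoc inv_mult_group\<close>)
  then obtain z where z: "z \<in> carrier G" "z \<noteq> \<one>" "\<And>a. a \<in> carrier G \<Longrightarrow> a \<otimes> z \<otimes> inv a = z"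
    by blast
  then have "x \<otimes> z = z \<otimes> x" if "x \<in> carrier G" for x
    using that by (metis inv_solve_right' m_closed)
  then show ?thesis using z by blast
qed

section \<open>Crossed homomorphisms on a cyclic p-group\<close>

text \<open>The exponents \<open>n\<close> and \<open>m\<close> are separate because quotients
  shrink \<open>Q\<close> but leave \<open>C\<close> and its generator alone.\<close>

locale cyclic_p_cocycle = cocycle +
  fixes p n m :: nat and \<gamma>
  assumes prime_p: "Factorial_Ring.prime p" and odd_p: "odd p"
    and order_C: "Coset.order C = p ^ n" and order_Q: "Coset.order Q = p ^ m"
    and gen: "\<gamma> \<in> carrier C" "carrier C = range (\<lambda>i::int. \<gamma> [^]\<^bsub>C\<^esub> i)"
begin

lemma finite_Q: "finite (carrier Q)"
  using order_Q prime_p by (metis card.infinite order_def power_eq_0_iff not_prime_0)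

lemma C_comm: "\<lbrakk>a \<in> carrier C; b \<in> carrier C\<rbrakk> \<Longrightarrow> a \<otimes>\<^bsub>C\<^esub> b = b \<otimes>\<^bsub>C\<^esub> a"
  using gen by (auto simp del: C.int_pow_closed) (metis C.int_pow_mult add.commute gen(1))

text \<open>Integer exponents reduce modulo \<open>p ^ n\<close>. Natural exponents are what the
  later induction on powers of \<open>\<gamma>\<close> can reach.\<close>

lemma C_nat_pow:
  assumes "a \<in> carrier C"
  obtains k :: nat where "a = \<gamma> [^]\<^bsub>C\<^esub> k"
proof -
  obtain i :: int where i: "a = \<gamma> [^]\<^bsub>C\<^esub> i" using assms gen by auto
  have N: "\<gamma> [^]\<^bsub>C\<^esub> (int (p ^ n)) = \<one>\<^bsub>C\<^esub>"
    by (metis C.pow_order_eq_1 gen(1) int_pow_int order_C)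
  have pos: "int (p ^ n) > 0" using prime_p prime_gt_0_nat by simp
  have "\<gamma> [^]\<^bsub>C\<^esub> i = \<gamma> [^]\<^bsub>C\<^esub> (int (p ^ n) * (i div int (p ^ n)) + i mod int (p ^ n))"
    by simp
  also have "\<dots> = (\<gamma> [^]\<^bsub>C\<^esub> int (p ^ n)) [^]\<^bsub>C\<^esub> (i div int (p ^ n)) \<otimes>\<^bsub>C\<^esub> \<gamma> [^]\<^bsub>C\<^esub> (i mod int (p ^ n))"
    using gen(1) by (simp only: C.int_pow_mult C.int_pow_pow)
  also have "\<dots> = \<gamma> [^]\<^bsub>C\<^esub> nat (i mod int (p ^ n))"
    using gen(1) pos by (simp only: N) (simp add: pow_nat)
  finally show thesis using that i by blast
qed

text \<open>As for the centre: \<open>p\<close> divides \<open>card S\<close>, hence not the number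
  of non-identity elements of \<open>S\<close>, which \<open>C\<close> permutes.\<close>

lemma fixed_point_in:
  assumes S: "subgroup S Q" "S \<noteq> {\<one>}"
    and inv: "\<And>a x. \<lbrakk>a \<in> carrier C; x \<in> S\<rbrakk> \<Longrightarrow> act a x \<in> S"
  shows "\<exists>x\<in>S. x \<noteq> \<one> \<and> (\<forall>a\<in>carrier C. act a x = x)"
proof -
  have SQ: "S \<subseteq> carrier Q" "\<one> \<in> S" using S by (auto simp: subgroup_def)
  then have fin: "finite S" using finite_Q finite_subset by blast
  have "p dvd card S"
    by (rule p_dvd_card_subgroup[OF prime_p order_Q S])
  moreover have "card S = Suc (card (S - {\<one>}))"
    using fin SQ by (metis card_Suc_Diff1)
  ultimately have nd: "\<not> p dvd card (S - {\<one>})"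
    using prime_p by (metis Suc_eq_plus1 dvd_add_right_iff not_prime_unit)
  have "\<exists>x\<in>S - {\<one>}. \<forall>a\<in>carrier C. act a x = x"
    by (rule p_group_fixed_point[OF C.is_group prime_p order_C _ _ _ _ nd])
      (use fin inv SQ in \<open>auto simp: act_mult act_one act_eq_one_iff subset_iff\<close>)
  then show ?thesis by blast
qed

end

section \<open>The minimal case: all proper invariant quotients are cyclic\<close>

locale minimal_cocycle = cyclic_p_cocycle +
  assumes proper_quotient_cyclic: "\<lbrakk>invariant_normal K; K \<noteq> {\<one>}\<rbrakk> \<Longrightarrow> cyclic_modulo K"
begin

text \<open>The centre \<open>Z\<close> is invariant and nontrivial, so \<open>Q\<close> is cyclic
  modulo \<open>Z\<close>; a group that is cyclic modulo its centre is abelian.\<close>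

lemma Q_comm:
  assumes "x \<in> carrier Q" "y \<in> carrier Q"
  shows "x \<otimes> y = y \<otimes> x"
proof (cases "carrier Q = {\<one>}")
  case True
  then show ?thesis using assms by simp
next
  case False
  define Z where "Z = {z\<in>carrier Q. \<forall>x\<in>carrier Q. x \<otimes> z = z \<otimes> x}"
  have ZQ: "z \<in> carrier Q" if "z \<in> Z" for z using that by (simp add: Z_def)
  have comm: "u \<otimes> z = z \<otimes> u" if "z \<in> Z" "u \<in> carrier Q" for z u
    using that by (simp add: Z_def)
  have sub: "subgroup Z Q"
  proof (rule subgroupI)
    fix a b assume a: "a \<in> Z"
    show "inv a \<in> Z"
      using a by (auto simp: Z_def) (metis inv_closed inv_solve_left inv_solve_right m_assoc m_closed)
    assume b: "b \<in> Z"
    show "a \<otimes> b \<in> Z"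
      unfolding Z_def
    proof (intro CollectI conjI ballI)
      fix u assume u: "u \<in> carrier Q"
      have "u \<otimes> (a \<otimes> b) = a \<otimes> (u \<otimes> b)"
        using u a b ZQ comm[OF a u] by (simp flip: m_assoc)
      then show "u \<otimes> (a \<otimes> b) = a \<otimes> b \<otimes> u"
        using u a b ZQ comm[OF b u] by (simp add: m_assoc)
    qed (use a b ZQ in simp)
  qed (auto simp: Z_def)
  have nor: "Z \<lhd> Q"
    unfolding normal_inv_iff
  proof (intro conjI ballI sub)
    fix u z assume uz: "u \<in> carrier Q" "z \<in> Z"
    then have "u \<otimes> z \<otimes> inv u = z"
      using comm[OF uz(2,1)] ZQ by (simp add: m_assoc)
    then show "u \<otimes> z \<otimes> inv u \<in> Z" using uz by simp
  qed
  have act_Z: "act a z \<in> Z" if "a \<in> carrier C" "z \<in> Z" for a z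
    unfolding Z_def
  proof (intro CollectI conjI ballI)
    fix u assume "u \<in> carrier Q"
    \<comment> \<open>To commute \<open>act a z\<close> with \<open>u\<close>, pull \<open>u\<close>
      back by the inverse of \<open>a\<close>, commute there with the central \<open>z\<close>, and
      apply \<open>act a\<close>.\<close>
    then have "act (inv\<^bsub>C\<^esub> a) u \<otimes> z = z \<otimes> act (inv\<^bsub>C\<^esub> a) u"
      using that comm by simp
    then have "act a (act (inv\<^bsub>C\<^esub> a) u \<otimes> z) = act a (z \<otimes> act (inv\<^bsub>C\<^esub> a) u)" by simp
    then show "u \<otimes> act a z = act a z \<otimes> u"
      using that ZQ \<open>u \<in> carrier Q\<close> by (simp add: act_distrib)
  qed (use that ZQ in simp)
  have "Z \<noteq> {\<one>}"
    using p_group_center_nontrivial[OF prime_p order_Q False] by (auto simp: Z_def)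
  then have "cyclic_modulo Z"
    using nor act_Z by (intro proper_quotient_cyclic) (auto simp: invariant_normal_def)
  then obtain g where g: "g \<in> carrier Q" "\<And>x. x \<in> carrier Q \<Longrightarrow> \<exists>k\<in>Z. \<exists>j::int. x = k \<otimes> g [^] j"
    by (auto simp: cyclic_modulo_def)
  obtain k1 j1 k2 j2 where k: "k1 \<in> Z" "k2 \<in> Z" "x = k1 \<otimes> g [^] (j1::int)" "y = k2 \<otimes> g [^] (j2::int)"
    using g(2) assms by meson
  have gg: "g [^] j1 \<otimes> g [^] j2 = g [^] j2 \<otimes> g [^] j1"
    using g(1) by (simp add: add.commute flip: int_pow_mult)
  have "x \<otimes> y = k1 \<otimes> (g [^] j1 \<otimes> k2) \<otimes> g [^] j2"
    using k g ZQ by (simp add: m_assoc)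
  also have "\<dots> = (k1 \<otimes> k2) \<otimes> (g [^] j1 \<otimes> g [^] j2)"
    using k g ZQ comm by (simp add: m_assoc)
  also have "\<dots> = (k2 \<otimes> k1) \<otimes> (g [^] j2 \<otimes> g [^] j1)"
    using comm[OF k(2) ZQ[OF k(1)]] gg by simp
  also have "\<dots> = k2 \<otimes> (g [^] j2 \<otimes> k1) \<otimes> g [^] j1"
    using k g ZQ comm[OF k(1), of "g [^] j2"] by (simp add: m_assoc)
  also have "\<dots> = y \<otimes> x"
    using k g ZQ by (simp add: m_assoc)
  finally show ?thesis .
qed

lemma Q_comm_group: "comm_group Q"
  by (rule group_comm_groupI) (rule Q_comm)

lemma subgroup_invariant_normal:
  assumes "subgroup K Q" "\<And>a x. \<lbrakk>a \<in> carrier C; x \<in> K\<rbrakk> \<Longrightarrow> act a x \<in> K"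
  shows "invariant_normal K"
  using assms comm_group.subgroup_imp_normal[OF Q_comm_group] by (auto simp: invariant_normal_def)

text \<open>The p-th powers form a nontrivial invariant subgroup, so some \<open>g\<close> generates
  \<open>Q\<close> modulo p-th powers. Such a \<open>g\<close> already generates \<open>Q\<close>,
  because p-th powers can be decomposed again and again until they vanish.\<close>

lemma exponent_p_or_cyclic:
  assumes "x \<in> carrier Q" "x [^] p \<noteq> \<one>"
  shows "cyclic_modulo {\<one>}"
proof -
  interpret comm_group Q by (rule Q_comm_group)
  define K where "K = (\<lambda>x. x [^] p) ` carrier Q"
  have "subgroup K Q"
    by (rule subgroupI) (auto simp: K_def image_iff nat_pow_distrib[symmetric] nat_pow_inv[symmetric])
  moreover have "act a y \<in> K" if "a \<in> carrier C" "y \<in> K" for a y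
    using that by (auto simp: K_def act_nat_pow)
  ultimately have "invariant_normal K" by (rule subgroup_invariant_normal)
  moreover have "K \<noteq> {\<one>}" using assms by (auto simp: K_def)
  ultimately have "cyclic_modulo K" by (rule proper_quotient_cyclic)
  then obtain g where g: "g \<in> carrier Q"
    "\<And>x. x \<in> carrier Q \<Longrightarrow> \<exists>y\<in>carrier Q. \<exists>j::int. x = y [^] p \<otimes> g [^] j"
    by (auto simp: cyclic_modulo_def K_def)
  \<comment> \<open>The decomposition is substituted into its own first factor, once for each
    increase of \<open>k\<close>.\<close>
  have "\<forall>x\<in>carrier Q. \<exists>y\<in>carrier Q. \<exists>j::int. x = y [^] (p ^ k) \<otimes> g [^] j" for k
  proof (induction k)
    case 0
    then show ?case by (metis int_pow_0 nat_pow_eone power_0 r_one)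
  next
    case (Suc k)
    show ?case
    proof
      fix x assume "x \<in> carrier Q"
      then obtain y j where y: "y \<in> carrier Q" "x = y [^] (p ^ k) \<otimes> g [^] (j::int)"
        using Suc by blast
      obtain z i where z: "z \<in> carrier Q" "y = z [^] p \<otimes> g [^] (i::int)"
        using g(2) y by blast
      have "y [^] (p ^ k) = z [^] (p ^ Suc k) \<otimes> g [^] (i * int (p ^ k))"
        using z g(1) int_pow_pow[OF g(1), of i "int (p ^ k)"]
        by (simp add: nat_pow_distrib nat_pow_pow int_pow_int del: of_nat_power)
      then have "x = z [^] (p ^ Suc k) \<otimes> g [^] (i * int (p ^ k) + j)"
        using y z g(1) by (simp add: m_assoc int_pow_mult)
      then show "\<exists>y\<in>carrier Q. \<exists>j::int. x = y [^] (p ^ Suc k) \<otimes> g [^] j"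
        using z by blast
    qed
  qed
  \<comment> \<open>At \<open>k = m\<close> the first factor is a power by the group order, hence
    trivial.\<close>
  from this[of m] have "\<forall>x\<in>carrier Q. \<exists>j::int. x = \<one> \<otimes> g [^] j"
    by (metis order_Q pow_order_eq_1)
  then show ?thesis using g(1) by (auto simp: cyclic_modulo_def)
qed

text \<open>Written additively, \<open>t\<close> is the action of \<gamma> minus the identity on a
  vector space over the field with \<open>p\<close> elements, and the claim is that \<open>t\<close>
  squares to zero. Modulo the fixed points \<open>F\<close> the group is cyclic and \<open>t\<close>
  kills \<open>F\<close>, so the image of \<open>t\<close> is generated by one element. If this
  image is nontrivial, it contains a nontrivial fixed point, and since the exponent is
  \<open>p\<close> this forces the whole image into \<open>F\<close>.\<close>

lemma act_gen_unipotent: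
  assumes ex: "\<And>x. x \<in> carrier Q \<Longrightarrow> x [^] p = \<one>" and x: "x \<in> carrier Q"
  defines "t \<equiv> \<lambda>x. act \<gamma> x \<otimes> inv x"
  shows "act \<gamma> (t x) = t x"
proof -
  interpret comm_group Q by (rule Q_comm_group)
  have tQ [simp]: "t x \<in> carrier Q" if "x \<in> carrier Q" for x
    using that gen(1) by (simp add: t_def)
  have t_mult: "t (x \<otimes> y) = t x \<otimes> t y" if "x \<in> carrier Q" "y \<in> carrier Q" for x y
    using that gen(1) by (simp add: t_def act_distrib inv_mult m_ac)
  have t_hom: "group_hom Q Q t"
    by unfold_locales (auto simp: hom_def t_mult)
  have t_pow: "t (x [^] (j::int)) = t x [^] j" if "x \<in> carrier Q" for x j
    by (rule group_hom.hom_int_pow[OF t_hom that])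
  define F where "F = {x\<in>carrier Q. \<forall>a\<in>carrier C. act a x = x}"
  have FQ: "x \<in> carrier Q" if "x \<in> F" for x using that by (simp add: F_def)
  have F_sub: "subgroup F Q"
    by (rule subgroupI) (auto simp: F_def act_distrib act_inv)
  have t_F: "t x = \<one>" if "x \<in> F" for x
    using that gen(1) by (auto simp: t_def F_def)
  show ?thesis
  proof (cases "t ` carrier Q = {\<one>}")
    case True
    then have "t x = \<one>" using x by blast
    then show ?thesis using gen(1) by simp
  next
    case False
    have T_sub: "subgroup (t ` carrier Q) Q"
      using group_hom.img_is_subgroup[OF t_hom] .
    \<comment> \<open>Since \<open>C\<close> is abelian, \<open>act a\<close> commutes with
      \<open>t\<close>.\<close>
    have T_inv: "act a y \<in> t ` carrier Q" if "a \<in> carrier C" "y \<in> t ` carrier Q" for a y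
    proof -
      obtain z where z: "z \<in> carrier Q" "y = t z" using \<open>y \<in> _\<close> by blast
      have "act a (act \<gamma> z) = act \<gamma> (act a z)"
        using z that gen(1) C_comm[of a \<gamma>] by (simp flip: act_mult)
      then have "act a y = t (act a z)"
        using z that gen(1) by (simp add: t_def act_distrib act_inv)
      then show ?thesis using z that by simp
    qed
    obtain y where y: "y \<in> t ` carrier Q" "y \<noteq> \<one>" "y \<in> F"
      using fixed_point_in[OF T_sub False T_inv] unfolding F_def by fastforce
    have "invariant_normal F"
      by (rule subgroup_invariant_normal[OF F_sub]) (auto simp: F_def)
    moreover have "F \<noteq> {\<one>}" using y by auto
    ultimately have "cyclic_modulo F" by (rule proper_quotient_cyclic)
    then obtain g where g: "g \<in> carrier Q" "\<And>x. x \<in> carrier Q \<Longrightarrow> \<exists>k\<in>F. \<exists>j::int. x = k \<otimes> g [^] j"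
      by (auto simp: cyclic_modulo_def)
    have t_g: "\<exists>j::int. t z = t g [^] j" if "z \<in> carrier Q" for z
      using g(2)[OF that] by (metis FQ g(1) int_pow_closed l_one t_F t_mult t_pow tQ)
    obtain j :: int where j: "y = t g [^] j" using y(1) t_g by auto
    \<comment> \<open>A multiple of \<open>p\<close> as exponent would make \<open>y\<close>
      trivial. Hence \<open>j\<close> is invertible modulo \<open>p\<close>, and \<open>t g\<close>
      is recovered as a power of the fixed point \<open>y\<close>.\<close>
    have "coprime j (int p)"
    proof (rule ccontr)
      assume "\<not> coprime j (int p)"
      then have "int p dvd j"
        using prime_p by (metis coprime_commute prime_imp_coprime prime_nat_int_transfer)
      then obtain i where "j = int p * i" by blast
      then have "y = (t g [^] p) [^] i"
        using j g(1) by (simp add: int_pow_pow flip: int_pow_int)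
      then show False using ex[of "t g"] g(1) y(2) by simp
    qed
    then obtain a b where ab: "a * j + b * int p = 1"
      by (metis bezout_int coprime_imp_gcd_eq_1)
    have "t g = t g [^] (j * a + int p * b)"
      using ab g(1) by (simp add: mult.commute)
    also have "\<dots> = (t g [^] j) [^] a \<otimes> (t g [^] int p) [^] b"
      using g(1) by (simp only: int_pow_mult int_pow_pow tQ int_pow_closed)
    also have "\<dots> = y [^] a"
      using g(1) ex[of "t g"] y FQ by (simp add: int_pow_int j)
    finally have "t g \<in> F"
      using y F_sub subgroup_int_pow_closed by metis
    then have "t x \<in> F"
      using t_g[OF x] F_sub subgroup_int_pow_closed by metis
    then show ?thesis using gen(1) by (simp add: F_def)
  qed
qed

text \<open>If \<open>Q\<close> is not cyclic, it has exponent \<open>p\<close>, and the values of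
  \<open>\<pi>\<close> on powers of \<gamma> repeat with period \<open>p\<close>. Surjectivity then
  bounds \<open>card (carrier Q)\<close> by \<open>p\<close>, and a p-group of at most
  \<open>p\<close> elements is cyclic.\<close>

lemma cyclic_modulo_one: "cyclic_modulo {\<one>}"
proof (rule ccontr)
  assume nc: "\<not> cyclic_modulo {\<one>}"
  interpret comm_group Q by (rule Q_comm_group)
  have ex: "x [^] p = \<one>" if "x \<in> carrier Q" for x
    using exponent_p_or_cyclic[OF that] nc by blast
  define t where "t = (\<lambda>x. act \<gamma> x \<otimes> inv x)"
  define u where "u = \<pi> \<gamma>"
  define v where "v = t u"
  have uv [simp]: "u \<in> carrier Q" "v \<in> carrier Q"
    using gen(1) by (simp_all add: u_def v_def t_def)
  have act_v: "act \<gamma> v = v"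
    using act_gen_unipotent[OF ex, of u] by (simp add: v_def t_def)
  have act_u: "act \<gamma> u = v \<otimes> u"
    using gen(1) by (simp add: v_def t_def m_assoc)
  \<comment> \<open>The powers are expanded as \<gamma> times the preceding power. Acting by
    \<gamma> multiplies \<open>u\<close> by the fixed element \<open>v\<close>, so step
    \<open>k\<close> contributes \<open>k\<close> further factors \<open>v\<close>, which add up to
    the binomial coefficient.\<close>
  have \<pi>_pow: "\<pi> (\<gamma> [^]\<^bsub>C\<^esub> (k::nat)) = u [^] k \<otimes> v [^] (k choose 2)" for k
  proof (induction k)
    case 0
    have "\<pi> \<one>\<^bsub>C\<^esub> \<otimes> \<one> = \<pi> \<one>\<^bsub>C\<^esub> \<otimes> \<pi> \<one>\<^bsub>C\<^esub>"
      using cocycle_mult[of "\<one>\<^bsub>C\<^esub>" "\<one>\<^bsub>C\<^esub>"] by (simp add: act_one)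
    then have "\<pi> \<one>\<^bsub>C\<^esub> = \<one>" by (metis C.one_closed cocycle_closed l_cancel one_closed)
    then show ?case by (simp add: numeral_2_eq_2)
  next
    case (Suc k)
    have "\<pi> (\<gamma> [^]\<^bsub>C\<^esub> Suc k) = u \<otimes> act \<gamma> (\<pi> (\<gamma> [^]\<^bsub>C\<^esub> k))"
      using gen(1) by (simp add: C_comm[of "\<gamma> [^]\<^bsub>C\<^esub> k"] cocycle_mult u_def)
    also have "\<dots> = u \<otimes> ((v [^] k \<otimes> u [^] k) \<otimes> v [^] (k choose 2))"
      using gen(1) by (simp add: Suc act_distrib act_nat_pow act_u act_v nat_pow_distrib)
    also have "\<dots> = (u [^] k \<otimes> u) \<otimes> (v [^] k \<otimes> v [^] (k choose 2))"
      by (simp add: m_ac)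
    also have "\<dots> = u [^] Suc k \<otimes> v [^] (Suc k choose 2)"
      by (simp add: nat_pow_mult numeral_2_eq_2)
    finally show ?case .
  qed
  \<comment> \<open>Here oddness enters: for \<open>p = 2\<close> the coefficient is 1.\<close>
  have "p dvd (p choose 2)"
    using prime_p odd_p prime_ge_2_nat[OF prime_p] by (intro dvd_choose_prime) (auto simp: le_less)
  then obtain q where q: "p choose 2 = p * q" by blast
  have \<pi>_p: "\<pi> (\<gamma> [^]\<^bsub>C\<^esub> p) = \<one>"
    by (simp add: \<pi>_pow q ex flip: nat_pow_pow)
  have \<pi>_add: "\<pi> (\<gamma> [^]\<^bsub>C\<^esub> (p * j + k)) = \<pi> (\<gamma> [^]\<^bsub>C\<^esub> k)" for j k :: nat
  proof (induction j)
    case (Suc j)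
    \<comment> \<open>Since \<open>t\<close> squares to zero, the i-th power of \<gamma> acts
      additively as the identity plus \<open>i\<close> times \<open>t\<close>. For
      \<open>i = p\<close> this is the identity, because the exponent is \<open>p\<close>.\<close>
    have act_p: "act (\<gamma> [^]\<^bsub>C\<^esub> i) (x) = t x [^] i \<otimes> x" if x: "x \<in> carrier Q" for x and i :: nat
    proof (induction i)
      case 0
      then show ?case using x by (simp add: act_one)
    next
      case (Suc i)
      have [simp]: "t x \<in> carrier Q" using gen(1) x by (simp add: t_def)
      have fixed: "act \<gamma> (t x) = t x"
        using act_gen_unipotent[OF ex x] by (simp add: t_def)
      have ax: "act \<gamma> x = t x \<otimes> x" using gen(1) x by (simp add: t_def m_assoc)
      have "act (\<gamma> [^]\<^bsub>C\<^esub> Suc i) x = act \<gamma> (act (\<gamma> [^]\<^bsub>C\<^esub> i) x)"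
        using gen(1) x by (simp add: C_comm[of "\<gamma> [^]\<^bsub>C\<^esub> i"] act_mult)
      also have "\<dots> = t x [^] i \<otimes> (t x \<otimes> x)"
        using gen(1) x by (simp add: Suc act_distrib act_nat_pow fixed ax)
      finally show ?case using x by (simp add: m_assoc)
    qed
    have "\<gamma> [^]\<^bsub>C\<^esub> (p * Suc j + k) = \<gamma> [^]\<^bsub>C\<^esub> p \<otimes>\<^bsub>C\<^esub> \<gamma> [^]\<^bsub>C\<^esub> (p * j + k)"
      using gen(1) by (simp add: C.nat_pow_mult add.assoc)
    then have "\<pi> (\<gamma> [^]\<^bsub>C\<^esub> (p * Suc j + k)) = act (\<gamma> [^]\<^bsub>C\<^esub> p) (\<pi> (\<gamma> [^]\<^bsub>C\<^esub> k))"
      using gen(1) by (simp add: cocycle_mult \<pi>_p Suc)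
    also have "\<dots> = \<pi> (\<gamma> [^]\<^bsub>C\<^esub> k)"
      using gen(1) by (simp add: act_p ex t_def)
    finally show ?case .
  qed simp
  have "carrier Q \<subseteq> (\<lambda>k. \<pi> (\<gamma> [^]\<^bsub>C\<^esub> k)) ` {..<p}"
  proof
    fix x assume "x \<in> carrier Q"
    then obtain a where "a \<in> carrier C" "x = \<pi> a" using cocycle_surj by blast
    moreover obtain k :: nat where "a = \<gamma> [^]\<^bsub>C\<^esub> k" using \<open>a \<in> carrier C\<close> by (rule C_nat_pow)
    ultimately have "x = \<pi> (\<gamma> [^]\<^bsub>C\<^esub> (k mod p))"
      using \<pi>_add[of "k div p" "k mod p"] by simp
    then show "x \<in> (\<lambda>k. \<pi> (\<gamma> [^]\<^bsub>C\<^esub> k)) ` {..<p}"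
      using prime_p prime_gt_0_nat by auto
  qed
  then have le: "card (carrier Q) \<le> p"
    by (metis card_image_le card_lessThan card_mono finite_imageI finite_lessThan le_trans)
  \<comment> \<open>Any non-identity \<open>x\<close> will do: it generates a subgroup whose order
    is a multiple of \<open>p\<close>, and \<open>Q\<close> has no more than \<open>p\<close>
    elements.\<close>
  obtain x where x: "x \<in> carrier Q" "x \<noteq> \<one>"
  proof (cases "carrier Q = {\<one>}")
    case True
    then have "cyclic_modulo {\<one>}" by (auto simp: cyclic_modulo_def)
    then show ?thesis using nc by blast
  qed (use that in blast)
  define H where "H = range (\<lambda>j::int. x [^] j)"
  have H: "subgroup H Q"
    by (rule subgroupI) (use x in \<open>auto simp: H_def simp flip: int_pow_neg int_pow_mult\<close>)
  have "x \<in> H" unfolding H_def using x by (metis int_pow_1 rangeI)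
  then have "p dvd card H"
    using x by (intro p_dvd_card_subgroup[OF prime_p order_Q H]) auto
  moreover have HQ: "H \<subseteq> carrier Q" using H by (simp add: subgroup_def)
  moreover have "card H > 0"
    using HQ \<open>x \<in> H\<close> finite_Q by (metis card_gt_0_iff empty_iff finite_subset)
  ultimately have "H = carrier Q"
    using le by (metis card_seteq dvd_imp_le finite_Q le_trans)
  then have "cyclic_modulo {\<one>}"
    using x unfolding cyclic_modulo_def H_def by (auto intro!: bexI[of _ x])
  then show False using nc by blast
qed

end

section \<open>Reduction to the minimal case\<close>

context cyclic_p_cocycle
begin

text \<open>The induction runs over subgroups \<open>K\<close> of one fixed \<open>Q\<close>, larger
  ones first, because \<open>Q Mod K\<close> has a different type from \<open>Q\<close>. Invariant
  normal subgroups strictly above \<open>K\<close> are covered by the induction hypothesis, which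
  makes \<open>Q Mod K\<close> an instance of the minimal case.\<close>

lemma cyclic_modulo_invariant_normal: "invariant_normal K \<Longrightarrow> cyclic_modulo K"
proof (induction "Coset.order Q - card K" arbitrary: K rule: less_induct)
  case less
  interpret K: normal K Q
    using less.prems by (simp add: invariant_normal_def)
  interpret QK: cocycle "Q Mod K" C "\<lambda>a S. act a ` S" "\<lambda>a. K #> \<pi> a"
    by (rule quotient_cocycle[OF less.prems])
  have rcos_mem: "K #> x = K \<longleftrightarrow> x \<in> K" if "x \<in> carrier Q" for x
    using that K.is_subgroup by (metis coset_join1 coset_join2 K.subset)
  have "Coset.order (Q Mod K) dvd p ^ m"
    by (metis FactGroup_def dvd_triv_left K.is_subgroup lagrange order_Q order_def partial_object.select_convs(1))
  then obtain m' where m': "Coset.order (Q Mod K) = p ^ m'"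
    using prime_p by (metis divides_primepow_nat)
  interpret QK: cyclic_p_cocycle "Q Mod K" C "\<lambda>a S. act a ` S" "\<lambda>a. K #> \<pi> a" p n m' \<gamma>
    by unfold_locales (fact prime_p odd_p order_C m' gen)+
  interpret QK: minimal_cocycle "Q Mod K" C "\<lambda>a S. act a ` S" "\<lambda>a. K #> \<pi> a" p n m' \<gamma>
  proof
    fix L assume L: "QK.invariant_normal L" "L \<noteq> {\<one>\<^bsub>Q Mod K\<^esub>}"
    interpret L: normal L "Q Mod K"
      using L by (simp add: QK.invariant_normal_def)
    have one_L: "K \<in> L" using L.one_closed by simp
    \<comment> \<open>The preimage of \<open>L\<close> under the projection; it is invariant, normal
      and strictly larger than \<open>K\<close>.\<close>
    define M where "M = {x\<in>carrier Q. K #> x \<in> L}"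
    have sub: "subgroup M Q"
    proof (rule subgroupI)
      fix x assume x: "x \<in> M"
      then have "inv\<^bsub>Q Mod K\<^esub> (K #> x) \<in> L" by (simp add: M_def)
      moreover have "inv\<^bsub>Q Mod K\<^esub> (K #> x) = K #> inv x"
        using x by (subst K.inv_FactGroup) (auto simp: M_def carrier_FactGroup K.rcos_inv)
      ultimately show "inv x \<in> M" using x by (simp add: M_def)
      fix y assume y: "y \<in> M"
      have "(K #> x) \<otimes>\<^bsub>Q Mod K\<^esub> (K #> y) \<in> L"
        using x y by (intro L.m_closed) (auto simp: M_def)
      then show "x \<otimes> y \<in> M"
        using x y by (simp add: M_def K.rcos_sum)
    next
      have "\<one> \<in> M" using one_L by (simp add: M_def rcos_mem K.one_closed coset_mult_one K.subset)
      then show "M \<noteq> {}" by blast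
    qed (auto simp: M_def)
    have "x \<otimes> h \<otimes> inv x \<in> M" if "x \<in> carrier Q" "h \<in> M" for x h
    proof -
      have "(K #> x) \<otimes>\<^bsub>Q Mod K\<^esub> (K #> h) \<otimes>\<^bsub>Q Mod K\<^esub> inv\<^bsub>Q Mod K\<^esub> (K #> x) \<in> L"
        using that by (intro L.inv_op_closed2) (auto simp: M_def carrier_FactGroup)
      moreover have "inv\<^bsub>Q Mod K\<^esub> (K #> x) = K #> inv x"
        using that by (subst K.inv_FactGroup) (auto simp: carrier_FactGroup K.rcos_inv)
      ultimately show ?thesis using that by (simp add: M_def K.rcos_sum)
    qed
    then have nor: "M \<lhd> Q" using sub by (simp add: normal_inv_iff)
    have "act a x \<in> M" if a: "a \<in> carrier C" and x: "x \<in> M" for a x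
    proof -
      have "act a ` (K #> x) \<in> L"
        using L a x by (auto simp: QK.invariant_normal_def M_def)
      then show ?thesis
        using a x by (simp add: M_def act_rcoset[OF less.prems])
    qed
    then have M: "invariant_normal M" using nor by (simp add: invariant_normal_def)
    have KM: "K \<subseteq> M"
    proof
      fix x assume x: "x \<in> K"
      then have "x \<in> carrier Q" using K.subset by blast
      then show "x \<in> M" using x one_L rcos_mem[of x] by (simp add: M_def)
    qed
    have "K \<noteq> M"
    proof
      assume eq: "K = M"
      have "S = K" if "S \<in> L" for S
      proof -
        obtain x where "x \<in> carrier Q" "S = K #> x"
          using \<open>S \<in> L\<close> L.subset by (auto simp: carrier_FactGroup)
        moreover from this have "x \<in> M" using \<open>S \<in> L\<close> by (simp add: M_def)
        ultimately show ?thesis using eq rcos_mem by blast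
      qed
      then have "L = {K}" using one_L by blast
      then show False using L(2) by simp
    qed
    moreover have MQ: "M \<subseteq> carrier Q" by (auto simp: M_def)
    ultimately have "card K < card M" "card M \<le> Coset.order Q"
      using KM finite_Q finite_subset[OF MQ] by (simp_all add: order_def psubset_card_mono psubset_eq card_mono)
    then have "Coset.order Q - card M < Coset.order Q - card K" by linarith
    then have "cyclic_modulo M" using less.hyps M by blast
    then obtain g where g: "g \<in> carrier Q" "\<And>x. x \<in> carrier Q \<Longrightarrow> \<exists>k\<in>M. \<exists>j::int. x = k \<otimes> g [^] j"
      by (auto simp: cyclic_modulo_def)
    \<comment> \<open>A generator of \<open>Q\<close> modulo \<open>M\<close> projects to one of
      \<open>Q Mod K\<close> modulo \<open>L\<close>, since cosets of elements of \<open>M\<close>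
      lie in \<open>L\<close>.\<close>
    show "QK.cyclic_modulo L"
      unfolding QK.cyclic_modulo_def
    proof (rule bexI[of _ "K #> g"], rule ballI)
      show "K #> g \<in> carrier (Q Mod K)" using g by (simp add: carrier_FactGroup)
      fix S assume "S \<in> carrier (Q Mod K)"
      then obtain x where x: "x \<in> carrier Q" "S = K #> x" by (auto simp: carrier_FactGroup)
      then obtain k j where k: "k \<in> M" "x = k \<otimes> g [^] (j::int)" using g by blast
      have "S = (K #> k) \<otimes>\<^bsub>Q Mod K\<^esub> (K #> g) [^]\<^bsub>Q Mod K\<^esub> j"
        using x k g by (simp add: K.FactGroup_int_pow K.rcos_sum M_def)
      then show "\<exists>k\<in>L. \<exists>j::int. S = k \<otimes>\<^bsub>Q Mod K\<^esub> (K #> g) [^]\<^bsub>Q Mod K\<^esub> j"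
        using k by (auto simp: M_def)
    qed
  qed
  obtain G where G: "G \<in> carrier (Q Mod K)"
    "\<And>S. S \<in> carrier (Q Mod K) \<Longrightarrow> \<exists>j::int. S = \<one>\<^bsub>Q Mod K\<^esub> \<otimes>\<^bsub>Q Mod K\<^esub> G [^]\<^bsub>Q Mod K\<^esub> j"
    using QK.cyclic_modulo_one unfolding QK.cyclic_modulo_def by blast
  obtain g where g: "g \<in> carrier Q" "G = K #> g"
    using G(1) by (auto simp: carrier_FactGroup)
  show "cyclic_modulo K"
    unfolding cyclic_modulo_def
  proof (rule bexI[of _ g], rule ballI)
    fix x assume x: "x \<in> carrier Q"
    then obtain j :: int where "K #> x = K #> g [^] j"
      using G(2)[of "K #> x"] g G(1) QK.int_pow_closed[OF G(1)]
      by (auto simp: carrier_FactGroup K.FactGroup_int_pow K.rcos_sum coset_mult_one K.subset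
          simp del: one_FactGroup mult_FactGroup)
    then have "x \<in> K #> g [^] j" using x rcos_self K.is_subgroup by metis
    then show "\<exists>k\<in>K. \<exists>j::int. x = k \<otimes> g [^] j" by (auto simp: r_coset_def)
  qed (fact g(1))
qed

theorem cyclic_group_Q: "cyclic_group Q"
proof -
  have "invariant_normal {\<one>}"
    using one_is_normal by (simp add: invariant_normal_def)
  then have "cyclic_modulo {\<one>}" by (rule cyclic_modulo_invariant_normal)
  then show ?thesis
    unfolding cyclic_modulo_def cyclic_group by (auto intro!: bexI)
qed

end

section \<open>Isomorphism of cyclic groups of equal order\<close>

lemma (in group) ord_generator:
  assumes "x \<in> carrier G" "carrier G = range (\<lambda>i::int. x [^] i)"
  shows "ord x = Coset.order G"
  using generate_pow_card[OF assms(1)] generate_pow[OF assms(1)] assms(2)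
  by (simp add: order_def full_SetCompr_eq)

lemma cyclic_groups_same_order_iso:
  assumes "group G" "group H" "cyclic_group G" "cyclic_group H"
    and order: "Coset.order G = Coset.order H"
  shows "G \<cong> H"
proof -
  interpret G: group G by fact
  interpret H: group H by fact
  obtain x where x: "x \<in> carrier G" "carrier G = range (\<lambda>i::int. x [^]\<^bsub>G\<^esub> i)"
    using assms(3) by (auto simp: G.cyclic_group)
  obtain y where y: "y \<in> carrier H" "carrier H = range (\<lambda>i::int. y [^]\<^bsub>H\<^esub> i)"
    using assms(4) by (auto simp: H.cyclic_group)
  have ord: "G.ord x = H.ord y"
    using G.ord_generator[OF x] H.ord_generator[OF y] order by simp
  have eq: "x [^]\<^bsub>G\<^esub> i = x [^]\<^bsub>G\<^esub> j \<longleftrightarrow> y [^]\<^bsub>H\<^esub> i = y [^]\<^bsub>H\<^esub> j" for i j :: int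
    using G.int_pow_eq[OF x(1)] H.int_pow_eq[OF y(1)] ord by simp
  \<comment> \<open>An arbitrary exponent may be chosen: by \<open>eq\<close>, exponents that agree
    on \<open>x\<close> agree on \<open>y\<close>.\<close>
  define h where "h z = y [^]\<^bsub>H\<^esub> (SOME i::int. z = x [^]\<^bsub>G\<^esub> i)" for z
  have h: "h (x [^]\<^bsub>G\<^esub> i) = y [^]\<^bsub>H\<^esub> i" for i :: int
  proof -
    have "x [^]\<^bsub>G\<^esub> i = x [^]\<^bsub>G\<^esub> (SOME j::int. x [^]\<^bsub>G\<^esub> i = x [^]\<^bsub>G\<^esub> j)"
      by (rule someI[of _ i]) simp
    then show ?thesis unfolding h_def using eq by metis
  qed
  have "h \<in> iso G H"
  proof (rule isoI)
    show "h \<in> hom G H"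
    proof (rule homI)
      fix a b assume "a \<in> carrier G" "b \<in> carrier G"
      then obtain i j :: int where "a = x [^]\<^bsub>G\<^esub> i" "b = x [^]\<^bsub>G\<^esub> j" using x(2) by blast
      then show "h (a \<otimes>\<^bsub>G\<^esub> b) = h a \<otimes>\<^bsub>H\<^esub> h b"
        using x(1) y(1) by (metis G.int_pow_mult H.int_pow_mult h)
    qed (use x y in \<open>auto simp: h_def\<close>)
    have "inj_on h (carrier G)"
      unfolding x(2) by (auto simp: inj_on_def h eq)
    moreover have "h ` carrier G = carrier H"
      unfolding x(2) y(2) by (simp add: image_image h)
    ultimately show "bij_betw h (carrier G) (carrier H)" by (simp add: bij_betw_def)
  qed
  then show ?thesis by (rule is_isoI)
qed

section \<open>From skew braces to crossed homomorphisms\<close>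

text \<open>The brace equation with \<open>a\<close> subtracted on the left says that each map of
  the action is additive. The crossed homomorphism law is cancellation of \<open>a\<close>;
  compatibility with products needs the formula \<open>mult_inv\<close> for multiplying a
  negative.\<close>

lemma skew_brace_cocycle:
  assumes A: "group A" and C: "group C" and eq: "carrier A = carrier C"
    and distrib: "\<And>a b c. \<lbrakk>a \<in> carrier C; b \<in> carrier C; c \<in> carrier C\<rbrakk> \<Longrightarrow>
      a \<otimes>\<^bsub>C\<^esub> (b \<otimes>\<^bsub>A\<^esub> c) = (a \<otimes>\<^bsub>C\<^esub> b \<otimes>\<^bsub>A\<^esub> inv\<^bsub>A\<^esub> a) \<otimes>\<^bsub>A\<^esub> (a \<otimes>\<^bsub>C\<^esub> c)"
  shows "cocycle A C (\<lambda>a x. inv\<^bsub>A\<^esub> a \<otimes>\<^bsub>A\<^esub> (a \<otimes>\<^bsub>C\<^esub> x)) (\<lambda>a. a)"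
proof -
  interpret A: group A by fact
  interpret C: group C by fact
  note [simp] = eq
  have inv_closed [simp]: "inv\<^bsub>A\<^esub> a \<in> carrier C" if "a \<in> carrier C" for a
    using that A.inv_closed by simp
  have m_closed [simp]: "a \<otimes>\<^bsub>A\<^esub> b \<in> carrier C" if "a \<in> carrier C" "b \<in> carrier C" for a b
    using that A.m_closed by simp
  have one_closed [simp]: "\<one>\<^bsub>A\<^esub> \<in> carrier C"
    using A.one_closed by simp
  \<comment> \<open>Both summands in the brace equation are taken to be zero. As a consequence the
    two identities coincide.\<close>
  have mult_one: "a \<otimes>\<^bsub>C\<^esub> \<one>\<^bsub>A\<^esub> = a" if "a \<in> carrier C" for a
  proof -
    have "a \<otimes>\<^bsub>C\<^esub> \<one>\<^bsub>A\<^esub> = (a \<otimes>\<^bsub>C\<^esub> \<one>\<^bsub>A\<^esub> \<otimes>\<^bsub>A\<^esub> inv\<^bsub>A\<^esub> a) \<otimes>\<^bsub>A\<^esub> (a \<otimes>\<^bsub>C\<^esub> \<one>\<^bsub>A\<^esub>)"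
      using distrib[of a "\<one>\<^bsub>A\<^esub>" "\<one>\<^bsub>A\<^esub>"] that by simp
    then have "a \<otimes>\<^bsub>C\<^esub> \<one>\<^bsub>A\<^esub> \<otimes>\<^bsub>A\<^esub> inv\<^bsub>A\<^esub> a = \<one>\<^bsub>A\<^esub>"
      using that by (metis A.r_cancel_one' A.m_closed C.m_closed eq inv_closed one_closed)
    then show ?thesis
      using that by (metis A.inv_equality A.inv_inv C.m_closed eq inv_closed one_closed)
  qed
  have one_eq: "\<one>\<^bsub>A\<^esub> = \<one>\<^bsub>C\<^esub>"
    using mult_one[of "\<one>\<^bsub>C\<^esub>"] by simp
  \<comment> \<open>Obtained by expanding the product of \<open>a\<close> with \<open>b\<close>
    minus \<open>b\<close>, which equals \<open>a\<close> by \<open>mult_one\<close>.\<close>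
  have mult_inv: "a \<otimes>\<^bsub>C\<^esub> inv\<^bsub>A\<^esub> b = a \<otimes>\<^bsub>A\<^esub> inv\<^bsub>A\<^esub> (a \<otimes>\<^bsub>C\<^esub> b) \<otimes>\<^bsub>A\<^esub> a"
    if "a \<in> carrier C" "b \<in> carrier C" for a b
  proof -
    have "a = (a \<otimes>\<^bsub>C\<^esub> b \<otimes>\<^bsub>A\<^esub> inv\<^bsub>A\<^esub> a) \<otimes>\<^bsub>A\<^esub> (a \<otimes>\<^bsub>C\<^esub> inv\<^bsub>A\<^esub> b)"
      using distrib[of a b "inv\<^bsub>A\<^esub> b"] that by (simp add: mult_one)
    then have "a \<otimes>\<^bsub>C\<^esub> inv\<^bsub>A\<^esub> b = inv\<^bsub>A\<^esub> (a \<otimes>\<^bsub>C\<^esub> b \<otimes>\<^bsub>A\<^esub> inv\<^bsub>A\<^esub> a) \<otimes>\<^bsub>A\<^esub> a"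
      using that A.inv_solve_left[of a "a \<otimes>\<^bsub>C\<^esub> b \<otimes>\<^bsub>A\<^esub> inv\<^bsub>A\<^esub> a" "a \<otimes>\<^bsub>C\<^esub> inv\<^bsub>A\<^esub> b"]
      by (metis A.inv_solve_left C.m_closed eq inv_closed m_closed)
    then show ?thesis using that by (simp add: A.inv_mult_group)
  qed
  show ?thesis
  proof
    fix a assume a: "a \<in> carrier C"
    show "(\<lambda>x. inv\<^bsub>A\<^esub> a \<otimes>\<^bsub>A\<^esub> (a \<otimes>\<^bsub>C\<^esub> x)) \<in> hom A A"
      using a by (auto intro!: homI simp: distrib A.m_assoc)
    fix b assume b: "b \<in> carrier C"
    show "a \<otimes>\<^bsub>C\<^esub> b = a \<otimes>\<^bsub>A\<^esub> (inv\<^bsub>A\<^esub> a \<otimes>\<^bsub>A\<^esub> (a \<otimes>\<^bsub>C\<^esub> b))"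
      using a b by (simp flip: A.m_assoc)
    fix x assume "x \<in> carrier A"
    then have x: "x \<in> carrier C" by simp
    show "inv\<^bsub>A\<^esub> (a \<otimes>\<^bsub>C\<^esub> b) \<otimes>\<^bsub>A\<^esub> (a \<otimes>\<^bsub>C\<^esub> b \<otimes>\<^bsub>C\<^esub> x) =
        inv\<^bsub>A\<^esub> a \<otimes>\<^bsub>A\<^esub> (a \<otimes>\<^bsub>C\<^esub> (inv\<^bsub>A\<^esub> b \<otimes>\<^bsub>A\<^esub> (b \<otimes>\<^bsub>C\<^esub> x)))"
    proof -
      have l: "inv\<^bsub>A\<^esub> a \<otimes>\<^bsub>A\<^esub> (a \<otimes>\<^bsub>A\<^esub> z) = z" "a \<otimes>\<^bsub>A\<^esub> (inv\<^bsub>A\<^esub> a \<otimes>\<^bsub>A\<^esub> z) = z"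
        if "z \<in> carrier C" for z
        using a that by (simp_all flip: A.m_assoc)
      show ?thesis
        using a b x by (simp add: distrib mult_inv A.m_assoc C.m_assoc l)
    qed
  next
    show "inv\<^bsub>A\<^esub> \<one>\<^bsub>C\<^esub> \<otimes>\<^bsub>A\<^esub> (\<one>\<^bsub>C\<^esub> \<otimes>\<^bsub>C\<^esub> x) = x" if "x \<in> carrier A" for x
      using that by (simp flip: one_eq)
  qed simp
qed

theorem theorem1p2:
  fixes B :: "('a, 'b) ring_scheme" and p n :: nat
  assumes "skew_brace B"
    and "Factorial_Ring.prime p" and "odd p"
    and "cyclic_group B" and "Coset.order B = p ^ n"
  shows "add_monoid B \<cong> B"
proof -
  interpret skew_brace B by fact
  interpret cocycle "add_monoid B" B
    "\<lambda>a x. inv\<^bsub>add_monoid B\<^esub> a \<otimes>\<^bsub>add_monoid B\<^esub> (a \<otimes>\<^bsub>B\<^esub> x)" "\<lambda>a. a"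
  proof (rule skew_brace_cocycle)
    show "group (add_monoid B)" by (rule additive.is_group)
    show "group B" by (rule multiplicative.is_group)
  qed (use brace_distrib in \<open>auto simp: a_minus_def a_inv_def\<close>)
  obtain \<gamma> where \<gamma>: "\<gamma> \<in> carrier B" "carrier B = range (\<lambda>i::int. \<gamma> [^]\<^bsub>B\<^esub> i)"
    using assms(4) multiplicative.cyclic_group by blast
  have order_eq: "Coset.order (add_monoid B) = Coset.order B" by (simp add: order_def)
  \<comment> \<open>The two groups share their carrier, so \<open>n\<close> serves as the exponent
    of both orders.\<close>
  interpret cyclic_p_cocycle "add_monoid B" B
    "\<lambda>a x. inv\<^bsub>add_monoid B\<^esub> a \<otimes>\<^bsub>add_monoid B\<^esub> (a \<otimes>\<^bsub>B\<^esub> x)" "\<lambda>a. a" p n n \<gamma>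
    using assms \<gamma> order_eq by unfold_locales auto
  show ?thesis
    by (rule cyclic_groups_same_order_iso)
      (use additive.is_group multiplicative.is_group cyclic_group_Q assms(4) order_eq in auto)
qed

end
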